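(* Let $Y$ be a random variable whose moment generating function $E[e^{tY}]$ exists for $|t|<r$, for some $r>0$. Define the probabilistic Stirling numbers of the second kind ${n\brace k}_{Y}$ by $\frac{1}{k!}(E[e^{tY}]-1)^{k}=\sum_{n=k}^{\infty}{n\brace k}_{Y}\frac{t^{n}}{n!}$ $(k\ge0)$, and define $B_{n}^{(c,Y)}(x)$ by $$e^{x(E[e^{\frac{Y}{2}t}]-E[e^{-\frac{Y}{2}t}])}= \sum_{n=0}^{\infty}B_{n}^{(c,Y)}(x)\frac{t^{n}}{n!}.$$ Then for every $n\ge 0$, $$B_{n}^{(c,Y)}(x)= \Big(\frac{1}{2}\Big)^{n}\sum_{k=0}^{n}\sum_{j=0}^{k}\sum_{l=0}^{n-k}(-1)^{j+k}\binom{n}{k}{n-k \brace l}_{Y}{k \brace j}_{Y}x^{j+l}.$$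
   Context: All generating-function identities are identities of power series in $t$. *)

theory Defs
  imports "HOL-Probability.Probability" "HOL-Complex_Analysis.Complex_Analysis"
begin

definition mgf :: "'a measure \<Rightarrow> ('a \<Rightarrow> real) \<Rightarrow> real \<Rightarrow> real" where
  "mgf M Y t = (\<integral>\<omega>. exp (t * Y \<omega>) \<partial>M)"

text \<open>
  \<open>egf_coeff f n\<close> is the number \<open>a\<^sub>n\<close> in the expansion \<open>f t = (\<Sum>n. a\<^sub>n * t ^ n / n!)\<close> at
  \<open>t = 0\<close>.  If \<open>f\<close> has no power series expansion at \<open>0\<close>, the value is unspecified; the lemmas
  \<open>prob_stirling2_gf\<close> and \<open>prob_central_bell_gf\<close> below show that this does not happen for
  the functions considered here.
\<close>
definition egf_coeff :: "(real \<Rightarrow> real) \<Rightarrow> nat \<Rightarrow> real" where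
  "egf_coeff f n = fact n * fps_nth (THE F. f has_fps_expansion F) n"

definition prob_stirling2 :: "'a measure \<Rightarrow> ('a \<Rightarrow> real) \<Rightarrow> nat \<Rightarrow> nat \<Rightarrow> real" where
  "prob_stirling2 M Y n k = egf_coeff (\<lambda>t. 1 / fact k * (mgf M Y t - 1) ^ k) n"

definition prob_central_bell :: "'a measure \<Rightarrow> ('a \<Rightarrow> real) \<Rightarrow> nat \<Rightarrow> real \<Rightarrow> real" where
  "prob_central_bell M Y n x =
     egf_coeff (\<lambda>t. exp (x * (mgf M (\<lambda>\<omega>. Y \<omega> / 2) t - mgf M (\<lambda>\<omega>. - (Y \<omega> / 2)) t))) n"


subsection \<open>The generating functions have power series expansions\<close>

lemma has_fps_expansion_real_nth:
  fixes f :: "real \<Rightarrow> real"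
  assumes "f has_fps_expansion F"
  shows "fps_nth F n = (deriv ^^ n) f 0 / fact n"
  using assms
proof (induction n arbitrary: f F)
  case 0
  have "eval_fps F 0 = f 0"
    using 0 eventually_nhds_x_imp_x unfolding has_fps_expansion_def by blast
  then show ?case by (simp add: eval_fps_at_0)
next
  case (Suc n)
  have "fps_nth (fps_deriv F) n = (deriv ^^ n) (deriv f) 0 / fact n"
    using Suc.IH[OF has_fps_expansion_deriv[OF Suc.prems]] .
  then show ?case
    by (simp add: funpow_Suc_right field_simps del: funpow.simps of_nat_Suc)
qed

lemma egf_coeff_eq:
  assumes "f has_fps_expansion F"
  shows "egf_coeff f n = fact n * fps_nth F n"
proof -
  have "(THE F. f has_fps_expansion F) = F"
    using assms by (intro the_equality) (auto simp: fps_eq_iff has_fps_expansion_real_nth)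
  then show ?thesis by (simp add: egf_coeff_def)
qed

lemma has_fps_expansion_egf_coeff:
  assumes "f has_fps_expansion F"
  shows "f has_fps_expansion Abs_fps (\<lambda>n. egf_coeff f n / fact n)"
proof -
  have "Abs_fps (\<lambda>n. egf_coeff f n / fact n) = F"
    by (simp add: fps_eq_iff egf_coeff_eq[OF assms])
  with assms show ?thesis by simp
qed

lemma mgf_has_fps_expansion:
  fixes Y :: "'a \<Rightarrow> real"
  assumes [measurable]: "Y \<in> borel_measurable M"
    and r: "r > 0"
    and int: "\<forall>t. \<bar>t\<bar> < r \<longrightarrow> integrable M (\<lambda>\<omega>. exp (t * Y \<omega>))"
  shows "mgf M Y has_fps_expansion Abs_fps (\<lambda>n. (\<integral>\<omega>. Y \<omega> ^ n \<partial>M) / fact n)"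
proof (rule has_fps_expansionI)
  have sums: "(\<lambda>n. fps_nth (Abs_fps (\<lambda>n. (\<integral>\<omega>. Y \<omega> ^ n \<partial>M) / fact n)) n * t ^ n) sums mgf M Y t"
    if t: "\<bar>t\<bar> < r" for t
  proof -
    define f where "f n \<omega> = (t * Y \<omega>) ^ n / fact n" for n \<omega>
    have f_sums: "(\<lambda>n. f n \<omega>) sums exp (t * Y \<omega>)" for \<omega>
      using exp_converges[of "t * Y \<omega>"] by (simp add: f_def field_simps)
    have norm_sums: "(\<lambda>n. norm (f n \<omega>)) sums exp \<bar>t * Y \<omega>\<bar>" for \<omega>
    proof -
      have "norm (f n \<omega>) = \<bar>t * Y \<omega>\<bar> ^ n / fact n" for n
        unfolding f_def by (simp add: power_abs abs_mult power_mult_distrib)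
      then show ?thesis
        using exp_converges[of "\<bar>t * Y \<omega>\<bar>"] by (simp only: real_scaleR_def divide_inverse mult.commute)
    qed
    have partial: "(\<Sum>i<n. norm (f i \<omega>)) \<le> exp \<bar>t * Y \<omega>\<bar>" for n \<omega>
      using sum_le_suminf[OF sums_summable[OF norm_sums], of "{..<n}" \<omega>]
        sums_unique[OF norm_sums, of \<omega>] by simp
    have term_le: "norm (f n \<omega>) \<le> exp \<bar>t * Y \<omega>\<bar>" for n \<omega>
      by (rule order_trans[OF member_le_sum[of n "{..<Suc n}" "\<lambda>i. norm (f i \<omega>)"] partial]) auto
    have [measurable]: "f n \<in> borel_measurable M" for n
      unfolding f_def by measurable
    have "integrable M (\<lambda>\<omega>. exp (t * Y \<omega>) + exp ((- t) * Y \<omega>))"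
      using t by (intro Bochner_Integration.integrable_add int[rule_format]) simp_all
    then have int_abs: "integrable M (\<lambda>\<omega>. exp \<bar>t * Y \<omega>\<bar>)"
    proof (rule Bochner_Integration.integrable_bound)
      show "AE \<omega> in M. norm (exp \<bar>t * Y \<omega>\<bar>) \<le> norm (exp (t * Y \<omega>) + exp ((- t) * Y \<omega>))"
      proof (rule AE_I2)
        fix \<omega>
        have "exp \<bar>u\<bar> \<le> exp u + exp (- u)" for u :: real
          by (cases "u \<ge> 0") auto
        from this[of "t * Y \<omega>"]
        show "norm (exp \<bar>t * Y \<omega>\<bar>) \<le> norm (exp (t * Y \<omega>) + exp ((- t) * Y \<omega>))"
          by simp
      qed
    qed measurable
    have f_int: "integrable M (f n)" for n
      by (rule Bochner_Integration.integrable_bound[OF int_abs]) (use term_le in auto)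
    have "summable (\<lambda>n. \<integral>\<omega>. norm (f n \<omega>) \<partial>M)"
    proof (rule summableI_nonneg_bounded)
      fix n
      have "(\<Sum>i<n. \<integral>\<omega>. norm (f i \<omega>) \<partial>M) = (\<integral>\<omega>. (\<Sum>i<n. norm (f i \<omega>)) \<partial>M)"
        using f_int by (intro Bochner_Integration.integral_sum[symmetric]) auto
      also have "\<dots> \<le> (\<integral>\<omega>. exp \<bar>t * Y \<omega>\<bar> \<partial>M)"
        using f_int int_abs partial
        by (intro integral_mono Bochner_Integration.integrable_sum) auto
      finally show "(\<Sum>i<n. \<integral>\<omega>. norm (f i \<omega>) \<partial>M) \<le> (\<integral>\<omega>. exp \<bar>t * Y \<omega>\<bar> \<partial>M)" .
    qed auto
    then have "(\<lambda>n. integral\<^sup>L M (f n)) sums (\<integral>\<omega>. (\<Sum>n. f n \<omega>) \<partial>M)"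
      using f_int sums_summable[OF norm_sums] by (intro sums_integral) auto
    moreover have "(\<integral>\<omega>. (\<Sum>n. f n \<omega>) \<partial>M) = mgf M Y t"
      unfolding mgf_def using sums_unique[OF f_sums] by simp
    moreover have "integral\<^sup>L M (f n) = (\<integral>\<omega>. Y \<omega> ^ n \<partial>M) / fact n * t ^ n" for n
      by (simp add: f_def[abs_def] power_mult_distrib)
    ultimately show ?thesis by simp
  qed
  have "eventually (\<lambda>t::real. t \<in> ball 0 r) (nhds 0)"
    using r by (intro eventually_nhds_in_open) auto
  then show "\<forall>\<^sub>F t in nhds 0.
      (\<lambda>n. fps_nth (Abs_fps (\<lambda>n. (\<integral>\<omega>. Y \<omega> ^ n \<partial>M) / fact n)) n * t ^ n) sums mgf M Y t"
    by eventually_elim (rule sums, simp)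
qed

lemma exp_has_fps_expansion_real:
  fixes g :: "real \<Rightarrow> real"
  assumes g: "g has_fps_expansion G" and g0: "fps_nth G 0 = 0"
  shows "\<exists>H. (\<lambda>t. exp (g t)) has_fps_expansion H"
proof -
  define Gc where "Gc = Abs_fps (\<lambda>n. complex_of_real (fps_nth G n))"
  have "conv_radius (fps_nth Gc) = conv_radius (fps_nth G)"
    unfolding Gc_def conv_radius_def by simp
  then have rad: "fps_conv_radius Gc = fps_conv_radius G"
    by (simp add: fps_conv_radius_def)
  have radG: "fps_conv_radius G > 0" and evG: "\<forall>\<^sub>F t in nhds 0. eval_fps G t = g t"
    using g by (auto simp: has_fps_expansion_def)
  have "eval_fps Gc has_fps_expansion Gc"
    using radG rad by (intro eval_fps_has_fps_expansion) simp
  then have "(exp \<circ> eval_fps Gc) has_fps_expansion fps_compose (fps_exp 1) Gc"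
    by (intro has_fps_expansion_compose has_fps_expansion_exp1) (auto simp: Gc_def g0)
  then obtain H where H: "(\<lambda>z. exp (eval_fps Gc z)) has_fps_expansion H"
    by (auto simp: o_def)
  have evH: "\<forall>\<^sub>F z in nhds 0. eval_fps H z = exp (eval_fps Gc z)" and radH: "fps_conv_radius H > 0"
    using H by (auto simp: has_fps_expansion_def)
  have lim: "filterlim complex_of_real (nhds 0) (nhds 0)"
    using tendsto_of_real[of "\<lambda>t::real. t" 0 "nhds 0"] filterlim_ident[of "nhds (0::real)"] by simp
  have near: "\<forall>\<^sub>F t in nhds 0. t \<in> eball (0::real) \<rho>" if "\<rho> > 0" for \<rho> :: ereal
    using that by (intro eventually_nhds_in_open) (auto simp: zero_ereal_def)
  have "\<forall>\<^sub>F t in nhds 0. (\<lambda>n. fps_nth (Abs_fps (\<lambda>n. Re (fps_nth H n))) n * t ^ n) sums exp (g t)"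
    using evG near[OF radG] near[OF radH] lim[unfolded filterlim_iff, rule_format, OF evH]
  proof eventually_elim
    case (elim t)
    have tG: "norm t < fps_conv_radius G" and tH: "norm (complex_of_real t) < fps_conv_radius H"
      using elim by (auto simp: eball_def dist_norm)
    have "(\<lambda>n. complex_of_real (fps_nth G n * t ^ n)) sums complex_of_real (g t)"
      using sums_eval_fps[OF tG] elim(1) by (simp only: sums_of_real_iff)
    then have "eval_fps Gc (complex_of_real t) = complex_of_real (g t)"
      by (simp add: eval_fps_def Gc_def sums_iff)
    then have "eval_fps H (complex_of_real t) = complex_of_real (exp (g t))"
      using elim(4) by (simp add: exp_of_real)
    then have "(\<lambda>n. fps_nth H n * complex_of_real t ^ n) sums complex_of_real (exp (g t))"
      using sums_eval_fps[OF tH] by simp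
    then have "(\<lambda>n. Re (fps_nth H n * complex_of_real t ^ n)) sums exp (g t)"
      using sums_Re by fastforce
    moreover have "Re (fps_nth H n * complex_of_real t ^ n) = Re (fps_nth H n) * t ^ n" for n
      by (simp only: of_real_power [symmetric] Re_complex_of_real times_complex.sel Im_complex_of_real)
    ultimately show ?case
      by simp
  qed
  then show ?thesis
    by (intro exI) (rule has_fps_expansionI)
qed

lemma prob_stirling2_expansion:
  fixes Y :: "'a \<Rightarrow> real"
  assumes "prob_space M" "Y \<in> borel_measurable M" "r > 0"
    and "\<forall>t. \<bar>t\<bar> < r \<longrightarrow> integrable M (\<lambda>\<omega>. exp (t * Y \<omega>))"
  defines "G \<equiv> Abs_fps (\<lambda>n. (\<integral>\<omega>. Y \<omega> ^ n \<partial>M) / fact n) - 1"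
  shows "fps_nth G 0 = 0"
    and "(\<lambda>t. mgf M Y t - 1) has_fps_expansion G"
    and "(\<lambda>t. 1 / fact k * (mgf M Y t - 1) ^ k) has_fps_expansion fps_const (1 / fact k) * G ^ k"
proof -
  interpret prob_space M by fact
  show "fps_nth G 0 = 0" by (simp add: G_def prob_space)
  show G: "(\<lambda>t. mgf M Y t - 1) has_fps_expansion G"
    unfolding G_def
    by (intro has_fps_expansion_diff has_fps_expansion_1 mgf_has_fps_expansion[OF assms(2-4)])
  show "(\<lambda>t. 1 / fact k * (mgf M Y t - 1) ^ k) has_fps_expansion fps_const (1 / fact k) * G ^ k"
    by (intro has_fps_expansion_cmult_left has_fps_expansion_power G)
qed

lemma prob_stirling2_eq_0:
  fixes Y :: "'a \<Rightarrow> real"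
  assumes "prob_space M" "Y \<in> borel_measurable M" "r > 0"
    and "\<forall>t. \<bar>t\<bar> < r \<longrightarrow> integrable M (\<lambda>\<omega>. exp (t * Y \<omega>))"
    and "n < k"
  shows "prob_stirling2 M Y n k = 0"
proof -
  note G = prob_stirling2_expansion[OF assms(1-4)]
  have "fps_nth ((Abs_fps (\<lambda>n. (\<integral>\<omega>. Y \<omega> ^ n \<partial>M) / fact n) - 1) ^ k) n = 0"
    using startsby_zero_power_prefix[OF G(1)] assms(5) by blast
  then show ?thesis
    unfolding prob_stirling2_def egf_coeff_eq[OF G(3)]
    by (simp only: fps_mult_left_const_nth mult_zero_right)
qed

text \<open>Together with \<open>prob_stirling2_eq_0\<close>, the series below starts at \<open>n = k\<close>.\<close>

lemma prob_stirling2_gf: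
  fixes Y :: "'a \<Rightarrow> real"
  assumes "prob_space M" "Y \<in> borel_measurable M" "r > 0"
    and "\<forall>t. \<bar>t\<bar> < r \<longrightarrow> integrable M (\<lambda>\<omega>. exp (t * Y \<omega>))"
  shows "(\<lambda>t. 1 / fact k * (mgf M Y t - 1) ^ k) has_fps_expansion
           Abs_fps (\<lambda>n. prob_stirling2 M Y n k / fact n)"
  unfolding prob_stirling2_def
  by (rule has_fps_expansion_egf_coeff[OF prob_stirling2_expansion(3)[OF assms]])

lemma prob_central_bell_gf:
  fixes Y :: "'a \<Rightarrow> real"
  assumes "prob_space M" "Y \<in> borel_measurable M" "r > 0"
    and int: "\<forall>t. \<bar>t\<bar> < r \<longrightarrow> integrable M (\<lambda>\<omega>. exp (t * Y \<omega>))"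
  shows "(\<lambda>t. exp (x * (mgf M (\<lambda>\<omega>. Y \<omega> / 2) t - mgf M (\<lambda>\<omega>. - (Y \<omega> / 2)) t)))
           has_fps_expansion Abs_fps (\<lambda>n. prob_central_bell M Y n x / fact n)"
proof -
  note [measurable] = assms(2)
  have meas1: "(\<lambda>\<omega>. Y \<omega> / 2) \<in> borel_measurable M"
    and meas2: "(\<lambda>\<omega>. - (Y \<omega> / 2)) \<in> borel_measurable M"
    by measurable
  have "\<forall>t. \<bar>t\<bar> < r \<longrightarrow> integrable M (\<lambda>\<omega>. exp (t * (Y \<omega> / 2)))"
  proof (intro allI impI)
    fix t :: real assume "\<bar>t\<bar> < r"
    then have "integrable M (\<lambda>\<omega>. exp ((t / 2) * Y \<omega>))" by (intro int[rule_format]) auto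
    then show "integrable M (\<lambda>\<omega>. exp (t * (Y \<omega> / 2)))" by simp
  qed
  note G1 = prob_stirling2_expansion(1,2)[OF assms(1) meas1 assms(3) this]
  have "\<forall>t. \<bar>t\<bar> < r \<longrightarrow> integrable M (\<lambda>\<omega>. exp (t * - (Y \<omega> / 2)))"
  proof (intro allI impI)
    fix t :: real assume "\<bar>t\<bar> < r"
    then have "integrable M (\<lambda>\<omega>. exp ((- t / 2) * Y \<omega>))" by (intro int[rule_format]) auto
    then show "integrable M (\<lambda>\<omega>. exp (t * - (Y \<omega> / 2)))" by simp
  qed
  note G2 = prob_stirling2_expansion(1,2)[OF assms(1) meas2 assms(3) this]
  obtain G where G: "fps_nth G 0 = 0"
    "(\<lambda>t. (mgf M (\<lambda>\<omega>. Y \<omega> / 2) t - 1) - (mgf M (\<lambda>\<omega>. - (Y \<omega> / 2)) t - 1)) has_fps_expansion G"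
  proof (rule that)
    show "(\<lambda>t. (mgf M (\<lambda>\<omega>. Y \<omega> / 2) t - 1) - (mgf M (\<lambda>\<omega>. - (Y \<omega> / 2)) t - 1))
            has_fps_expansion
            (Abs_fps (\<lambda>n. (\<integral>\<omega>. (Y \<omega> / 2) ^ n \<partial>M) / fact n) - 1) -
            (Abs_fps (\<lambda>n. (\<integral>\<omega>. (- (Y \<omega> / 2)) ^ n \<partial>M) / fact n) - 1)"
      by (rule has_fps_expansion_diff[OF G1(2) G2(2)])
  qed (simp only: fps_sub_nth[of "F - 1" for F] G1(1) G2(1) diff_self)
  have "(\<lambda>t. x * (mgf M (\<lambda>\<omega>. Y \<omega> / 2) t - mgf M (\<lambda>\<omega>. - (Y \<omega> / 2)) t))
          has_fps_expansion fps_const x * G"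
    using has_fps_expansion_cmult_left[OF G(2), of x] by simp
  from exp_has_fps_expansion_real[OF this] obtain H where
    "(\<lambda>t. exp (x * (mgf M (\<lambda>\<omega>. Y \<omega> / 2) t - mgf M (\<lambda>\<omega>. - (Y \<omega> / 2)) t))) has_fps_expansion H"
    using G(1) by auto
  then show ?thesis
    unfolding prob_central_bell_def by (rule has_fps_expansion_egf_coeff)
qed

end

theory Submission
  imports Defs
begin

text \<open>
  Since \<open>E[e\<^bsup>(Y/2)t\<^esup>] - E[e\<^bsup>-(Y/2)t\<^esup>] = (E[e\<^bsup>(Y/2)t\<^esup>] - 1) - (E[e\<^bsup>-(Y/2)t\<^esup>] - 1)\<close>, the generating
  function of the central Bell polynomials is a product of two functions of the form
  \<open>exp (c (E[e\<^bsup>sYt\<^esup>] - 1))\<close>, with \<open>(s, c) = (1/2, x)\<close> and \<open>(s, c) = (-1/2, -x)\<close>.  Each factor has the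
  coefficients \<open>s\<^sup>n \<Sum>\<^sub>l S\<^sub>Y(n, l) c\<^sup>l / n!\<close>, and the claim is the Cauchy product of the two expansions.
\<close>

lemma has_fps_expansion_real_unique:
  fixes f :: "real \<Rightarrow> real"
  assumes "f has_fps_expansion F" and "f has_fps_expansion G"
  shows "F = G"
  using assms by (simp add: fps_eq_iff has_fps_expansion_real_nth)

text \<open>
  The expansion \<open>H\<close> of \<open>exp (c * g t)\<close> is identified with the formal composition because both solve
  \<open>H' = c G' H\<close> with constant term \<open>1\<close>.
\<close>
lemma has_fps_expansion_exp_compose_real:
  fixes g :: "real \<Rightarrow> real"
  assumes g: "g has_fps_expansion G" and g0: "fps_nth G 0 = 0"
  shows "(\<lambda>t. exp (c * g t)) has_fps_expansion (fps_exp c oo G)"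
proof -
  \<comment> \<open>\<open>eval_fps G\<close> replaces \<open>g\<close>, with which it agrees near
    0, because its derivative is explicit throughout the disc of convergence.\<close>
  define e where "e t = exp (c * eval_fps G t)" for t
  have rad: "fps_conv_radius G > 0" and ev: "\<forall>\<^sub>F t in nhds 0. eval_fps G t = g t"
    using g by (auto simp: has_fps_expansion_def)
  have eval: "eval_fps G has_fps_expansion G"
    using rad by (rule eval_fps_has_fps_expansion)
  then have "(\<lambda>t. c * eval_fps G t) has_fps_expansion fps_const c * G"
    by (rule has_fps_expansion_cmult_left)
  then obtain H where H: "e has_fps_expansion H"
    unfolding e_def using exp_has_fps_expansion_real g0 by force
  have "\<forall>\<^sub>F t in nhds 0. t \<in> eball 0 (fps_conv_radius G)"
    using rad by (intro eventually_nhds_in_open) (auto simp: zero_ereal_def)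
  then have "\<forall>\<^sub>F t in nhds 0. deriv e t = c * eval_fps (fps_deriv G) t * e t"
  proof eventually_elim
    case (elim t)
    then have G_deriv: "(eval_fps G has_field_derivative eval_fps (fps_deriv G) t) (at t)"
      by (intro has_field_derivative_eval_fps) (auto simp: eball_def dist_norm)
    have "(e has_field_derivative c * eval_fps (fps_deriv G) t * e t) (at t)"
      using DERIV_fun_exp[OF DERIV_cmult[OF G_deriv, of c]]
      unfolding e_def[abs_def] by (simp add: mult_ac)
    then show ?case by (rule DERIV_imp_deriv)
  qed
  moreover have "eval_fps (fps_deriv G) has_fps_expansion fps_deriv G"
    using rad fps_conv_radius_deriv[of G] by (intro eval_fps_has_fps_expansion) auto
  then have "(\<lambda>t. c * eval_fps (fps_deriv G) t * e t) has_fps_expansion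
      fps_const c * fps_deriv G * H"
    by (intro has_fps_expansion_mult has_fps_expansion_cmult_left H)
  ultimately have "deriv e has_fps_expansion fps_const c * fps_deriv G * H"
    by (subst has_fps_expansion_cong[OF _ refl]) auto
  \<comment> \<open>Two expansions of \<open>deriv e\<close> must coincide, so the differential
    equation for functions becomes one for formal series.\<close>
  then have deriv_H: "fps_deriv H = fps_const c * fps_deriv G * H"
    using has_fps_expansion_real_unique[OF has_fps_expansion_deriv[OF H]] by simp
  have H0: "fps_nth H 0 = 1"
    using has_fps_expansion_real_nth[OF H, of 0] g0 by (simp add: e_def eval_fps_at_0)
  \<comment> \<open>\<open>?E (- c)\<close> serves as integrating factor: it is the inverse of
    \<open>?E c\<close>, and its product with \<open>H\<close> turns out to be constant.\<close>
  let ?E = "\<lambda>c. fps_exp c oo G"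
  have E_mult: "?E (- c) * ?E c = 1"
    by (simp flip: fps_compose_mult_distrib[OF g0] fps_exp_add_mult)
  have "fps_deriv (?E (- c)) = fps_const (- c) * ?E (- c) * fps_deriv G"
    by (simp only: fps_compose_deriv[OF g0] fps_exp_deriv fps_compose_mult_distrib[OF g0]
        fps_const_compose)
  then have "fps_deriv (?E (- c) * H) =
      (fps_const c + fps_const (- c)) * (?E (- c) * fps_deriv G * H)"
    by (simp only: fps_deriv_mult deriv_H) (simp only: ring_distribs mult_ac add_ac)
  then have "fps_deriv (?E (- c) * H) = 0"
    by simp
  then have "?E (- c) * H = 1"
    by (simp only: fps_deriv_eq_0_iff fps_mult_nth_0) (simp add: H0)
  then have "H = ?E c"
    using E_mult mult.assoc[of "?E c" "?E (- c)" H] by (simp add: mult.commute)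
  moreover have "\<forall>\<^sub>F t in nhds 0. exp (c * g t) = e t"
    using ev by eventually_elim (simp add: e_def)
  ultimately show ?thesis
    using H by (simp add: has_fps_expansion_cong)
qed

text \<open>Scaling \<open>Y\<close> by \<open>s\<close> substitutes \<open>s * t\<close> for
  \<open>t\<close>, which multiplies the n-th coefficient by \<open>s ^ n\<close>. The Stirling
  numbers arise because composing with \<open>fps_exp c\<close> sums the powers \<open>G ^ l\<close>
  with weights \<open>c ^ l / fact l\<close>. The bound on \<open>s\<close> keeps
  \<open>t * s\<close> in the interval where the exponential moments exist.\<close>

lemma exp_mgf_scaled_has_fps_expansion:
  fixes Y :: "'a \<Rightarrow> real"
  assumes M: "prob_space M" and Y[measurable]: "Y \<in> borel_measurable M" and r: "r > 0"
    and int: "\<forall>t. \<bar>t\<bar> < r \<longrightarrow> integrable M (\<lambda>\<omega>. exp (t * Y \<omega>))"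
    and s: "\<bar>s\<bar> \<le> 1"
  shows "(\<lambda>t. exp (c * (mgf M (\<lambda>\<omega>. s * Y \<omega>) t - 1))) has_fps_expansion
    Abs_fps (\<lambda>n. s ^ n * (\<Sum>l = 0..n. prob_stirling2 M Y n l * c ^ l) / fact n)"
proof -
  define G where "G = Abs_fps (\<lambda>n. (\<integral>\<omega>. Y \<omega> ^ n \<partial>M) / fact n) - 1"
  define Gs where "Gs = Abs_fps (\<lambda>n. (\<integral>\<omega>. (s * Y \<omega>) ^ n \<partial>M) / fact n) - 1"
  note expansion = prob_stirling2_expansion[OF M Y r int, folded G_def]
  have meas: "(\<lambda>\<omega>. s * Y \<omega>) \<in> borel_measurable M"
    by measurable
  have int_s: "\<forall>t. \<bar>t\<bar> < r \<longrightarrow> integrable M (\<lambda>\<omega>. exp (t * (s * Y \<omega>)))"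
  proof (intro allI impI)
    fix t :: real assume "\<bar>t\<bar> < r"
    moreover have "\<bar>t * s\<bar> \<le> \<bar>t\<bar>"
      using mult_left_mono[OF s, of "\<bar>t\<bar>"] by (simp add: abs_mult)
    ultimately have "integrable M (\<lambda>\<omega>. exp ((t * s) * Y \<omega>))"
      by (intro int[rule_format]) simp
    then show "integrable M (\<lambda>\<omega>. exp (t * (s * Y \<omega>)))" by (simp add: mult.assoc)
  qed
  note expansion_s = prob_stirling2_expansion(1,2)[OF M meas r int_s, folded Gs_def]
  have Gs: "Gs = G oo (fps_const s * fps_X)"
    by (simp add: fps_eq_iff G_def Gs_def power_mult_distrib)
  have "fps_nth (fps_exp c oo Gs) n = s ^ n * (\<Sum>l = 0..n. prob_stirling2 M Y n l * c ^ l) / fact n"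
    for n
  proof -
    have stirling: "prob_stirling2 M Y n l = fact n * fps_nth (G ^ l) n / fact l" for l
      unfolding prob_stirling2_def egf_coeff_eq[OF expansion(3)] by simp
    have "fps_nth (Gs ^ l) n = s ^ n * fps_nth (G ^ l) n" for l
      unfolding Gs by (subst fps_compose_power) simp_all
    then show ?thesis
      by (simp add: fps_compose_nth stirling sum_distrib_left sum_divide_distrib field_simps)
  qed
  then have "fps_exp c oo Gs =
      Abs_fps (\<lambda>n. s ^ n * (\<Sum>l = 0..n. prob_stirling2 M Y n l * c ^ l) / fact n)"
    by (simp add: fps_eq_iff)
  with has_fps_expansion_exp_compose_real[OF expansion_s(2,1), of c] show ?thesis by simp
qed

theorem theorem2p4:
  fixes M :: "'a measure" and Y :: "'a \<Rightarrow> real" and r x :: real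
  assumes "prob_space M"
    and "Y \<in> borel_measurable M"
    and "r > 0"
    and "\<forall>t. \<bar>t\<bar> < r \<longrightarrow> integrable M (\<lambda>\<omega>. exp (t * Y \<omega>))"
  shows "\<forall>n. prob_central_bell M Y n x =
    (1 / 2) ^ n * (\<Sum>k = 0..n. \<Sum>j = 0..k. \<Sum>l = 0..n - k.
      (- 1) ^ (j + k) * real (n choose k) * prob_stirling2 M Y (n - k) l * prob_stirling2 M Y k j
        * x ^ (j + l))"
proof
  fix n
  let ?S = "prob_stirling2 M Y"
  \<comment> \<open>\<open>A s c k\<close> is \<open>fact k\<close> times the k-th coefficient of
    the factor with parameters \<open>s\<close> and \<open>c\<close>.\<close>
  define A where "A s c k = s ^ k * (\<Sum>l = 0..k. ?S k l * c ^ l)" for s c :: real and k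
  note factor = exp_mgf_scaled_has_fps_expansion[OF assms, folded A_def]
  \<comment> \<open>The factor with \<open>s = - 1 / 2\<close> stands first so that the Cauchy index
    \<open>k\<close> belongs to it, as the claimed formula requires.\<close>
  have "(\<lambda>t. exp (- x * (mgf M (\<lambda>\<omega>. (- 1 / 2) * Y \<omega>) t - 1))
          * exp (x * (mgf M (\<lambda>\<omega>. (1 / 2) * Y \<omega>) t - 1)))
      has_fps_expansion Abs_fps (\<lambda>k. A (- 1 / 2) (- x) k / fact k)
        * Abs_fps (\<lambda>k. A (1 / 2) x k / fact k)"
    by (intro has_fps_expansion_mult factor) simp_all
  then have "(\<lambda>t. exp (x * (mgf M (\<lambda>\<omega>. Y \<omega> / 2) t - mgf M (\<lambda>\<omega>. - (Y \<omega> / 2)) t)))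
      has_fps_expansion Abs_fps (\<lambda>k. A (- 1 / 2) (- x) k / fact k)
        * Abs_fps (\<lambda>k. A (1 / 2) x k / fact k)"
    by (simp add: algebra_simps flip: exp_add)
  then have "prob_central_bell M Y n x =
      fact n * (\<Sum>k = 0..n. A (- 1 / 2) (- x) k / fact k * (A (1 / 2) x (n - k) / fact (n - k)))"
    unfolding prob_central_bell_def by (simp add: egf_coeff_eq fps_mult_nth)
  also have "\<dots> = (\<Sum>k = 0..n. real (n choose k) * A (- 1 / 2) (- x) k * A (1 / 2) x (n - k))"
    by (simp add: sum_distrib_left binomial_fact mult_ac)
  also have "\<dots> = (\<Sum>k = 0..n. (1 / 2) ^ n * (\<Sum>j = 0..k. \<Sum>l = 0..n - k.
      (- 1) ^ (j + k) * real (n choose k) * ?S (n - k) l * ?S k j * x ^ (j + l)))"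
  proof (rule sum.cong[OF refl])
    fix k assume "k \<in> {0..n}"
    \<comment> \<open>The powers of 1/2 merge since \<open>k + (n - k) = n\<close>; what remains is
      the sign \<open>(- 1) ^ k\<close>.\<close>
    then have half: "(- 1 / 2) ^ k * (1 / 2) ^ (n - k) = (- 1) ^ k * (1 / 2 :: real) ^ n"
      using power_add[of "1 / 2 :: real" k "n - k"] power_mult_distrib[of "- 1" "1 / 2 :: real" k]
      by simp
    have "real (n choose k) * A (- 1 / 2) (- x) k * A (1 / 2) x (n - k) =
        ((- 1 / 2) ^ k * (1 / 2) ^ (n - k)) * (real (n choose k) *
          ((\<Sum>j = 0..k. ?S k j * (- x) ^ j) * (\<Sum>l = 0..n - k. ?S (n - k) l * x ^ l)))"
      by (simp only: A_def mult_ac)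
    also have "\<dots> = (1 / 2) ^ n * (\<Sum>j = 0..k. \<Sum>l = 0..n - k.
        (- 1) ^ (j + k) * real (n choose k) * ?S (n - k) l * ?S k j * x ^ (j + l))"
      unfolding half sum_product
      \<comment> \<open>Expanding \<open>(- x) ^ j\<close> supplies the other sign,
        \<open>(- 1) ^ j\<close>.\<close>
      unfolding sum_distrib_left power_minus[of x] power_add
      by (intro sum.cong refl) (simp only: mult_ac)
    finally show "real (n choose k) * A (- 1 / 2) (- x) k * A (1 / 2) x (n - k) =
        (1 / 2) ^ n * (\<Sum>j = 0..k. \<Sum>l = 0..n - k.
          (- 1) ^ (j + k) * real (n choose k) * ?S (n - k) l * ?S k j * x ^ (j + l))" .
  qed
  also have "\<dots> = (1 / 2) ^ n * (\<Sum>k = 0..n. \<Sum>j = 0..k. \<Sum>l = 0..n - k.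
      (- 1) ^ (j + k) * real (n choose k) * ?S (n - k) l * ?S k j * x ^ (j + l))"
    by (rule sum_distrib_left[symmetric])
  finally show "prob_central_bell M Y n x = (1 / 2) ^ n * (\<Sum>k = 0..n. \<Sum>j = 0..k. \<Sum>l = 0..n - k.
      (- 1) ^ (j + k) * real (n choose k) * ?S (n - k) l * ?S k j * x ^ (j + l))" .
qed

end
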